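(* Let $q$ be a prime power and $m,n$ positive integers. For $0\le r\le \min\{n,m\}$, $$q^{r(m+n-r)} \le V_r(q^m,n) < K_q^{-1} q^{r(m+n-r)},$$ where $K_q=\prod_{j=1}^\infty (1-q^{-j})$.
   Context: For $\mathbf{x}\in \mathrm{GF}(q^m)^n$, the rank weight $\mathrm{rk}(\mathbf{x})$ is the maximum number of coordinates of $\mathbf{x}$ that are linearly independent over $\mathrm{GF}(q)$; the rank distance is $d_R(\mathbf{x},\mathbf{y})=\mathrm{rk}(\mathbf{x}-\mathbf{y})$. $V_r(q^m,n)$ is the volume (number of vectors) of a ball of rank radius $r$ in $\mathrm{GF}(q^m)^n$, i.e. the number of vectors of rank weight at most $r$. *)

theory Defs
  imports
    "HOL-Algebra.Embedded_Algebras"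
    "HOL-Analysis.Infinite_Products"
    "HOL-Number_Theory.Prime_Powers"
begin

text \<open>
  Vectors over a field \<open>F\<close> are lists over its carrier. A subfield \<open>K\<close> of \<open>F\<close> plays the role of
  \<open>GF(q)\<close> inside \<open>F = GF(q^m)\<close>.
\<close>

definition vectors :: "('a, 'b) ring_scheme \<Rightarrow> nat \<Rightarrow> 'a list set" where
  "vectors F n = {x. length x = n \<and> set x \<subseteq> carrier F}"

text \<open>
  Here \<open>nths x I\<close> is the list of the coordinates of \<open>x\<close> at the positions in \<open>I\<close>. Independence is that
  of a family: a list with a repeated entry is dependent. The maximum is over a nonempty set,
  because the empty list is independent.
\<close>

definition rank_weight :: "('a, 'b) ring_scheme \<Rightarrow> 'a set \<Rightarrow> 'a list \<Rightarrow> nat" where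
  "rank_weight F K x = Max {card I | I. I \<subseteq> {..<length x} \<and> ring.independent F K (nths x I)}"

definition rank_ball_volume :: "('a, 'b) ring_scheme \<Rightarrow> 'a set \<Rightarrow> nat \<Rightarrow> nat \<Rightarrow> nat" where
  "rank_ball_volume F K n r = card {x \<in> vectors F n. rank_weight F K x \<le> r}"

text \<open>The index is shifted: the factor at \<open>j\<close> is \<open>1 - q^{-(j+1)}\<close>.\<close>

definition K_const :: "nat \<Rightarrow> real" where
  "K_const q = (\<Prod>j. 1 - 1 / real q ^ Suc j)"

end

(*
A vector has rank weight at most r exactly when its coordinates lie in the span of some
independent list b of length r.

Lower bound: the first r coordinates are arbitrary, and for each choice of them the other n - r
coordinates may range over an r-dimensional subspace that contains the first r.

Upper bound: count the pairs (x, b) with x in (Span b)^n in two ways.  Each b admits q^(rn) vectors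
x, and each x of rank at most r admits at least all the ordered bases of one r-dimensional space,
which number (q^r - 1)(q^r - q)...(q^r - q^(r-1)) > K_q q^(r^2).
*)
theory Submission
  imports Defs
begin

section \<open>Counting vectors and independent lists in finite-dimensional spaces over
  \<open>K\<close>\<close>

context ring
begin

context
  fixes K :: "'a set"
  assumes K: "subfield K R"
begin

text \<open>Spans are handled through library rules about \<open>Span\<close>; the defining equation
  as a rewrite rule would unfold it and keep those rules from matching.\<close>

declare Span.simps [simp del]

text \<open>By independence every element of the span has exactly one list of coefficients, so
  \<open>combine\<close> is a bijection from the lists over \<open>K\<close> of this length.\<close>

lemma card_Span:
  assumes "finite K" "independent K Us"
  shows "card (Span K Us) = card K ^ length Us" and "finite (Span K Us)"
proof -
  let ?L = "{Ks. set Ks \<subseteq> K \<and> length Ks = length Us}"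
  have carr: "set Us \<subseteq> carrier R"
    by (rule independent_in_carrier[OF assms(2)])
  have Span: "Span K Us = (\<lambda>Ks. combine Ks Us) ` ?L"
    unfolding Span_eq_combine_set_length_version[OF K carr] by auto
  have "inj_on (\<lambda>Ks. combine Ks Us) ?L"
  proof (rule inj_onI)
    fix Ks Ls
    assume A: "Ks \<in> ?L" "Ls \<in> ?L" "combine Ks Us = combine Ls Us"
    then have "combine Ks Us \<in> Span K Us"
      unfolding Span by blast
    from unique_decomposition[OF K assms(2) this] A show "Ks = Ls"
      by auto
  qed
  then have card: "card (Span K Us) = card ?L"
    unfolding Span by (rule card_image)
  show "finite (Span K Us)"
    unfolding Span using finite_lists_length_eq[OF assms(1)] by blast
  show "card (Span K Us) = card K ^ length Us"
    unfolding card by (rule card_lists_length_eq[OF assms(1)])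
qed

lemma card_dimension:
  assumes "finite K" "dimension d K E"
  shows "card E = card K ^ d" and "finite E"
  using exists_base[OF K assms(2)] card_Span[OF assms(1)] by auto

text \<open>An independent list of length \<open>k\<close> is extended at its head by any vector of
  \<open>E\<close> outside its span, which leaves \<open>card K ^ d - card K ^ k\<close> choices.
  For \<open>k > d\<close> the factor at \<open>i = d\<close> is zero, in agreement with the absence
  of such lists.\<close>

lemma card_independent_lists:
  assumes "finite K" "dimension d K E"
  shows "finite {Us. length Us = k \<and> set Us \<subseteq> E \<and> independent K Us}"
    and "card {Us. length Us = k \<and> set Us \<subseteq> E \<and> independent K Us} = (\<Prod>i<k. card K ^ d - card K ^ i)"
proof -
  let ?S = "\<lambda>k::nat. {Us. length Us = k \<and> set Us \<subseteq> E \<and> independent K Us}"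
  have finE: "finite E" and cardE: "card E = card K ^ d"
    using card_dimension[OF assms] by auto
  have E: "E \<subseteq> carrier R"
    by (rule space_subgroup_props(1)[OF K assms(2)])
  show fin: "finite (?S k)" for k
    by (rule finite_subset[OF _ finite_lists_length_eq[OF finE, of k]]) auto
  show "card (?S k) = (\<Prod>i<k. card K ^ d - card K ^ i)"
  proof (induction k)
    case 0
    have "?S 0 = {[]}"
      by auto
    then show ?case
      by simp
  next
    case (Suc k)
    have "?S (Suc k) = (\<lambda>(Us, u). u # Us) ` (SIGMA Us:?S k. E - Span K Us)"
    proof (intro equalityI subsetI)
      fix x
      assume x: "x \<in> ?S (Suc k)"
      then obtain u Us where "x = u # Us"
        by (cases x) auto
      with x show "x \<in> (\<lambda>(Us, u). u # Us) ` (SIGMA Us:?S k. E - Span K Us)"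
        using independent_backwards[of K u Us] by (intro image_eqI[of _ _ "(Us, u)"]) auto
    qed (use E in \<open>auto intro!: li_Cons\<close>)
    moreover have "inj_on (\<lambda>(Us, u). u # Us) (SIGMA Us:?S k. E - Span K Us)"
      by (auto intro!: inj_onI)
    ultimately have "card (?S (Suc k)) = card (SIGMA Us:?S k. E - Span K Us)"
      by (simp add: card_image)
    also have "\<dots> = (\<Sum>Us\<in>?S k. card (E - Span K Us))"
      using fin finE by (intro card_SigmaI) auto
    also have "\<dots> = (\<Sum>Us\<in>?S k. card K ^ d - card K ^ k)"
    proof (rule sum.cong[OF refl])
      fix Us
      assume Us: "Us \<in> ?S k"
      \<comment> \<open>Writing \<open>E\<close> as a span allows monotonicity of
        \<open>Span\<close> to place \<open>Span K Us\<close> inside \<open>E\<close>.\<close>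
      obtain Bs where Bs: "set Bs \<subseteq> carrier R" "Span K Bs = E"
        using exists_base[OF K assms(2)] by blast
      have "Span K Us \<subseteq> E"
        using mono_Span_subset[OF K, of Us Bs] Us Bs by blast
      then show "card (E - Span K Us) = card K ^ d - card K ^ k"
        using Us card_Span[OF assms(1), of Us] cardE by (auto simp: card_Diff_subset)
    qed
    finally show ?case
      using Suc.IH by simp
  qed
qed

text \<open>A list of all elements spans the carrier and can be thinned out to a base. The length of
  this base is then read off from the order, since powers of \<open>card K > 1\<close> determine
  their exponents.\<close>

lemma dimension_carrier:
  assumes "finite (carrier R)" "card K > 1" "order R = card K ^ m"
  shows "dimension m K (carrier R)"
proof -
  have finK: "finite K"
    using assms(2) card.infinite by fastforce
  obtain Us where Us: "set Us = carrier R"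
    using finite_list[OF assms(1)] by blast
  obtain Vs where Vs: "set Vs \<subseteq> carrier R" "independent K Vs" "Span K Vs = Span K Us"
    using filter_base[OF K, of Us] Us by auto
  have Span: "Span K Vs = carrier R"
    using Vs(3) Span_base_incl[OF K, of Us] Span_subgroup_props(1)[OF K, of Us] Us by auto
  have "card K ^ length Vs = card K ^ m"
    using card_Span(1)[OF finK Vs(2)] Span assms(3) by (simp add: order_def)
  then show ?thesis
    using dimension_independent[OF Vs(2)] Span power_inject_exp[OF assms(2)] by metis
qed

section \<open>Rank weight and spans of independent lists of prescribed length\<close>

text \<open>\<open>Us\<close> is completed to a base of \<open>E\<close>, and then surplus new
  vectors are discarded.\<close>

lemma independent_extend:
  assumes "dimension d K E" "independent K Us" "set Us \<subseteq> E" "length Us \<le> r" "r \<le> d"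
  shows "\<exists>b. independent K b \<and> length b = r \<and> set b \<subseteq> E \<and> Span K Us \<subseteq> Span K b"
proof -
  obtain Vs where Vs: "length (Vs @ Us) = d" "independent K (Vs @ Us)" "Span K (Vs @ Us) = E"
    using complete_base[OF K assms(1-3)] by blast
  \<comment> \<open>The completion has length \<open>d\<close>, so dropping \<open>d - r\<close>
    vectors leaves \<open>r\<close>. They are dropped from the front, where the new vectors stand,
    so \<open>Us\<close> stays intact.\<close>
  let ?b = "drop (d - r) Vs @ Us"
  have "independent K (take (d - r) Vs @ ?b)"
    using Vs(2) by (metis append_assoc append_take_drop_id)
  then have b: "independent K ?b"
    by (rule independent_split(1)[OF K])
  have carr: "set (Vs @ Us) \<subseteq> carrier R"
    by (rule independent_in_carrier[OF Vs(2)])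
  have "set (Vs @ Us) \<subseteq> E"
    using Span_base_incl[OF K carr] Vs(3) by simp
  then have "set ?b \<subseteq> E"
    using set_drop_subset[of "d - r" Vs] by auto
  moreover have "Span K Us \<subseteq> Span K ?b"
    using independent_in_carrier[OF b] by (intro mono_Span_sublist[OF K]) auto
  moreover have "length ?b = r"
    using Vs(1) assms(4,5) by auto
  ultimately show ?thesis
    using b by blast
qed

text \<open>Greedy selection from the right: a coordinate is kept exactly when it lies outside the
  span of those already kept.\<close>

lemma exists_independent_nths:
  assumes "set x \<subseteq> carrier R"
  shows "\<exists>I\<subseteq>{..<length x}. independent K (nths x I) \<and> set x \<subseteq> Span K (nths x I)"
  using assms
proof (induction x)
  case (Cons u x)
  then obtain I where I: "I \<subseteq> {..<length x}" "independent K (nths x I)" "set x \<subseteq> Span K (nths x I)"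
    by auto
  have u: "u \<in> carrier R"
    using Cons.prems by auto
  show ?case
  proof (cases "u \<in> Span K (nths x I)")
    case True
    \<comment> \<open>Positions of the tail move up by one, and position 0, that of
      \<open>u\<close>, is not selected.\<close>
    have "nths (u # x) (Suc ` I) = nths x I"
      by (simp add: nths_Cons image_iff)
    then show ?thesis
      using I True by (intro exI[of _ "Suc ` I"]) auto
  next
    case False
    have eq: "nths (u # x) (insert 0 (Suc ` I)) = u # nths x I"
      by (simp add: nths_Cons image_iff)
    have ind: "independent K (u # nths x I)"
      using False I(2) u by (intro li_Cons)
    have "u \<in> Span K (u # nths x I)"
      using Span_base_incl[OF K independent_in_carrier[OF ind]] by simp
    moreover have "set x \<subseteq> Span K (u # nths x I)"
      using mono_Span[OF K independent_in_carrier[OF I(2)] u] I(3) by blast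
    ultimately show ?thesis
      using I ind by (intro exI[of _ "insert 0 (Suc ` I)"]) (auto simp: eq)
  qed
qed auto

text \<open>Forwards, an independent selection that spans all coordinates has at most
  \<open>r\<close> entries and is padded to length \<open>r\<close>, for which there is room because
  \<open>r \<le> d\<close>. Backwards, no independent list inside the span of \<open>r\<close>
  vectors is longer than \<open>r\<close>.\<close>

lemma rank_weight_le_iff:
  assumes "dimension d K (carrier R)" "set x \<subseteq> carrier R" "r \<le> d"
  shows "rank_weight R K x \<le> r \<longleftrightarrow> (\<exists>b. independent K b \<and> length b = r \<and> set x \<subseteq> Span K b)"
proof -
  let ?M = "{card I |I. I \<subseteq> {..<length x} \<and> independent K (nths x I)}"
  have fin: "finite ?M"
    by (rule finite_surj[of "Pow {..<length x}" _ card]) auto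
  have "0 \<in> ?M"
    by (intro CollectI exI[of _ "{}"]) auto
  then have "rank_weight R K x \<le> r \<longleftrightarrow> (\<forall>k\<in>?M. k \<le> r)"
    unfolding rank_weight_def using fin Max_le_iff[OF fin] by blast
  also have "\<dots> \<longleftrightarrow> (\<forall>I\<subseteq>{..<length x}. independent K (nths x I) \<longrightarrow> card I \<le> r)"
    by blast
  also have "\<dots> \<longleftrightarrow> (\<exists>b. independent K b \<and> length b = r \<and> set x \<subseteq> Span K b)"
  proof
    assume le: "\<forall>I\<subseteq>{..<length x}. independent K (nths x I) \<longrightarrow> card I \<le> r"
    obtain I where I: "I \<subseteq> {..<length x}" "independent K (nths x I)" "set x \<subseteq> Span K (nths x I)"
      using exists_independent_nths[OF assms(2)] by blast
    have "{i. i < length x \<and> i \<in> I} = I"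
      using I(1) by auto
    then have "length (nths x I) \<le> r"
      using le I by (simp add: length_nths)
    then show "\<exists>b. independent K b \<and> length b = r \<and> set x \<subseteq> Span K b"
      using independent_extend[OF assms(1) I(2) independent_in_carrier[OF I(2)] _ assms(3)] I(3)
      by blast
  next
    assume "\<exists>b. independent K b \<and> length b = r \<and> set x \<subseteq> Span K b"
    then obtain b where b: "independent K b" "length b = r" "set x \<subseteq> Span K b"
      by blast
    show "\<forall>I\<subseteq>{..<length x}. independent K (nths x I) \<longrightarrow> card I \<le> r"
    proof (intro allI impI)
      fix I
      assume I: "I \<subseteq> {..<length x}" "independent K (nths x I)"
      have "set (nths x I) \<subseteq> Span K b"
        using b(3) set_nths_subset by fast
      then have "length (nths x I) \<le> r"
        using independent_length_le[OF K I(2) b(1)] b(2) by blast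
      moreover have "{i. i < length x \<and> i \<in> I} = I"
        using I(1) by auto
      ultimately show "card I \<le> r"
        by (simp add: length_nths)
    qed
  qed
  finally show ?thesis .
qed

section \<open>Lower and upper counting bounds for the rank ball\<close>

context
  fixes m n r :: nat
  assumes fin: "finite K" and dim: "dimension m K (carrier R)" and rm: "r \<le> m"
begin

lemma rank_ball_eq:
  "{x \<in> vectors R n. rank_weight R K x \<le> r} =
    {x. length x = n \<and> (\<exists>b. independent K b \<and> length b = r \<and> set x \<subseteq> Span K b)}"
proof -
  have "set x \<subseteq> carrier R" if "independent K b" "set x \<subseteq> Span K b" for x b
    using that Span_subgroup_props(1)[OF K independent_in_carrier] by blast
  then show ?thesis
    unfolding vectors_def using rank_weight_le_iff[OF dim _ rm] by blast
qed

lemma finite_rank_ball: "finite {x \<in> vectors R n. rank_weight R K x \<le> r}"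
proof (rule finite_subset)
  show "finite {x. set x \<subseteq> carrier R \<and> length x = n}"
    using card_dimension(2)[OF fin dim] by (rule finite_lists_length_eq)
qed (auto simp: vectors_def)

lemma rank_ball_volume_ge:
  assumes "r \<le> n"
  shows "card K ^ (r * (m + n - r)) \<le> rank_ball_volume R K n r"
proof -
  let ?Y = "{y. set y \<subseteq> carrier R \<and> length y = r}"
  have finR: "finite (carrier R)" and cardR: "card (carrier R) = card K ^ m"
    using card_dimension[OF fin dim] by auto
  \<comment> \<open>The list \<open>y\<close> may be dependent, so an independent selection spanning
    its entries is padded to length \<open>r\<close>. One such list \<open>A y\<close> is then fixed
    for each \<open>y\<close>.\<close>
  have "\<exists>b. independent K b \<and> length b = r \<and> set y \<subseteq> Span K b" if y: "y \<in> ?Y" for y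
  proof -
    obtain I where I: "I \<subseteq> {..<length y}" "independent K (nths y I)" "set y \<subseteq> Span K (nths y I)"
      using exists_independent_nths[of y] y by blast
    have "length (nths y I) \<le> card {..<r}"
      unfolding length_nths using y by (intro card_mono) auto
    then show ?thesis
      using independent_extend[OF dim I(2) independent_in_carrier[OF I(2)] _ rm] I(3) by auto
  qed
  then obtain A where A: "\<And>y. y \<in> ?Y \<Longrightarrow> independent K (A y) \<and> length (A y) = r \<and> set y \<subseteq> Span K (A y)"
    by metis
  let ?Z = "\<lambda>y. {z. set z \<subseteq> Span K (A y) \<and> length z = n - r}"
  have cardZ: "card (?Z y) = (card K ^ r) ^ (n - r)" and finZ: "finite (?Z y)" if "y \<in> ?Y" for y
    using A[OF that] card_Span[OF fin, of "A y"] card_lists_length_eq[of "Span K (A y)" "n - r"]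
      finite_lists_length_eq[of "Span K (A y)" "n - r"]
    by simp_all
  have "card (Sigma ?Y ?Z) = (\<Sum>y\<in>?Y. card (?Z y))"
    using finZ finite_lists_length_eq[OF finR] by (intro card_SigmaI) auto
  also have "\<dots> = card ?Y * (card K ^ r) ^ (n - r)"
    using cardZ by simp
  also have "\<dots> = card K ^ (m * r + r * (n - r))"
    by (simp add: card_lists_length_eq[OF finR] cardR power_add power_mult)
  also have "m * r + r * (n - r) = r * (m + n - r)"
    using assms by (simp add: diff_mult_distrib2 distrib_left mult.commute)
  finally have "card K ^ (r * (m + n - r)) = card (Sigma ?Y ?Z)" ..
  also have "\<dots> \<le> card {x \<in> vectors R n. rank_weight R K x \<le> r}"
  proof (rule card_inj_on_le[OF _ _ finite_rank_ball])
    show "inj_on (\<lambda>(y, z). y @ z) (Sigma ?Y ?Z)"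
    proof (rule inj_onI, unfold split_paired_all mem_Sigma_iff split_conv)
      fix y z y' z'
      assume A: "y \<in> ?Y \<and> z \<in> ?Z y" "y' \<in> ?Y \<and> z' \<in> ?Z y'" "y @ z = y' @ z'"
      \<comment> \<open>Both prefixes have length \<open>r\<close>, so the concatenation determines
        where it splits.\<close>
      then have "length y = length y'"
        by simp
      with A(3) show "(y, z) = (y', z')"
        by simp
    qed
    show "(\<lambda>(y, z). y @ z) ` Sigma ?Y ?Z \<subseteq> {x \<in> vectors R n. rank_weight R K x \<le> r}"
      unfolding rank_ball_eq
    proof (rule image_subsetI, unfold split_paired_all mem_Sigma_iff split_conv)
      fix y z
      assume yz: "y \<in> ?Y \<and> z \<in> ?Z y"
      then have "set (y @ z) \<subseteq> Span K (A y)"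
        using A[of y] by auto
      then show "y @ z \<in> {x. length x = n \<and> (\<exists>b. independent K b \<and> length b = r \<and> set x \<subseteq> Span K b)}"
        using yz assms A[of y] by auto
    qed
  qed
  finally show ?thesis
    unfolding rank_ball_volume_def .
qed

text \<open>The double count of pairs, with the product left unevaluated: it is the number of
  ordered bases of an \<open>r\<close>-dimensional space over \<open>K\<close>.\<close>

lemma rank_ball_volume_mult_le:
  "rank_ball_volume R K n r * (\<Prod>i<r. card K ^ r - card K ^ i) \<le> card K ^ (r * (m + n))"
proof -
  let ?X = "{x \<in> vectors R n. rank_weight R K x \<le> r}"
  let ?B = "{b. length b = r \<and> set b \<subseteq> carrier R \<and> independent K b}"
  let ?Bx = "\<lambda>x. {b \<in> ?B. set x \<subseteq> Span K b}"
  let ?Xb = "\<lambda>b. {x. set x \<subseteq> Span K b \<and> length x = n}"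
  have finR: "finite (carrier R)" and cardR: "card (carrier R) = card K ^ m"
    using card_dimension[OF fin dim] by auto
  have finB: "finite ?B"
    by (rule card_independent_lists(1)[OF fin dim])
  have cardXb: "card (?Xb b) = (card K ^ r) ^ n" and finXb: "finite (?Xb b)" if "b \<in> ?B" for b
    using that card_Span[OF fin, of b] card_lists_length_eq[of "Span K b" n]
      finite_lists_length_eq[of "Span K b" n]
    by simp_all
  have finBx: "finite (?Bx x)" for x
    using finB by (rule rev_finite_subset) blast
  have le: "(\<Prod>i<r. card K ^ r - card K ^ i) \<le> card (?Bx x)" if x: "x \<in> ?X" for x
  proof -
    obtain b where b: "independent K b" "length b = r" "set x \<subseteq> Span K b"
      using x unfolding rank_ball_eq by blast
    have d: "dimension r K (Span K b)"
      using dimension_independent[OF b(1)] b(2) by simp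
    have carr: "Span K b \<subseteq> carrier R"
      by (rule space_subgroup_props(1)[OF K d])
    have "(\<Prod>i<r. card K ^ r - card K ^ i) =
        card {b'. length b' = r \<and> set b' \<subseteq> Span K b \<and> independent K b'}"
      by (rule card_independent_lists(2)[OF fin d, symmetric])
    also have "\<dots> \<le> card (?Bx x)"
    proof (rule card_mono[OF finBx])
      show "{b'. length b' = r \<and> set b' \<subseteq> Span K b \<and> independent K b'} \<subseteq> ?Bx x"
      proof
        fix b'
        assume b': "b' \<in> {b'. length b' = r \<and> set b' \<subseteq> Span K b \<and> independent K b'}"
        \<comment> \<open>An independent list of \<open>r\<close> vectors in an
          \<open>r\<close>-dimensional space spans it, so \<open>b'\<close> serves for
          \<open>x\<close> as well as \<open>b\<close> does.\<close>
        then have "Span K b' = Span K b"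
          using independent_length_eq_dimension[OF K d, of b'] by blast
        then show "b' \<in> ?Bx x"
          using b b' carr by blast
      qed
    qed
    finally show ?thesis .
  qed
  have "rank_ball_volume R K n r * (\<Prod>i<r. card K ^ r - card K ^ i) \<le> (\<Sum>x\<in>?X. card (?Bx x))"
    unfolding rank_ball_volume_def using sum_bounded_below[of ?X, OF le] by simp
  also have "\<dots> = card (Sigma ?X ?Bx)"
    using finite_rank_ball finBx by (intro card_SigmaI[symmetric]) blast+
  also have "\<dots> \<le> card (Sigma ?B ?Xb)"
  proof (rule card_inj_on_le)
    show "inj_on prod.swap (Sigma ?X ?Bx)"
      by simp
    show "prod.swap ` Sigma ?X ?Bx \<subseteq> Sigma ?B ?Xb"
      by (auto simp: vectors_def)
    show "finite (Sigma ?B ?Xb)"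
      by (rule finite_SigmaI[OF finB finXb])
  qed
  also have "\<dots> = card ?B * (card K ^ r) ^ n"
    using card_SigmaI[OF finB, of ?Xb] finXb cardXb by simp
  \<comment> \<open>The number of independent lists is bounded crudely by that of all lists of
    length \<open>r\<close>.\<close>
  also have "\<dots> \<le> card {b. set b \<subseteq> carrier R \<and> length b = r} * (card K ^ r) ^ n"
    using finite_lists_length_eq[OF finR] by (intro mult_le_mono1 card_mono) auto
  also have "\<dots> = card K ^ (m * r + r * n)"
    by (simp add: card_lists_length_eq[OF finR] cardR power_add power_mult)
  also have "m * r + r * n = r * (m + n)"
    by (simp add: distrib_left)
  finally show ?thesis .
qed

end

end

end

section \<open>The infinite product \<open>K_const\<close> and its partial products\<close>

text \<open>The deviations of the factors from 1 form an absolutely summable geometric series, and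
  no factor is zero.\<close>

lemma convergent_prod_K_const:
  assumes "q > 1"
  shows "convergent_prod (\<lambda>j. 1 - 1 / real q ^ Suc j)"
proof -
  have "summable (\<lambda>j. (1 / real q) * (1 / real q) ^ j)"
    using assms by (intro summable_mult summable_geometric) auto
  then have "summable (\<lambda>j. \<bar>- (1 / real q ^ Suc j)\<bar>)"
    by (simp add: power_divide)
  moreover have "- (1 / real q ^ Suc j) \<noteq> -1" for j
    using assms one_less_power[of "real q" "Suc j"] by auto
  ultimately show ?thesis
    using summable_imp_convergent_prod_real[of "\<lambda>j. - (1 / real q ^ Suc j)"] by simp
qed

lemma K_const_factor:
  assumes "q > 1"
  shows "0 < 1 - 1 / real q ^ Suc j" "1 - 1 / real q ^ Suc j < 1"
  using assms one_less_power[of "real q" "Suc j"] by (auto simp del: power_Suc)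

lemma K_const_pos: "q > 1 \<Longrightarrow> K_const q > 0"
  unfolding K_const_def by (intro less_0_prodinf convergent_prod_K_const K_const_factor)

text \<open>Since all factors are below 1, the limit is at most each partial product. Comparing with
  \<open>Suc r\<close> factors instead of \<open>r\<close> gives strictness, as the extra factor is
  below 1.\<close>

lemma K_const_less:
  assumes "q > 1"
  shows "K_const q < (\<Prod>j<r. 1 - 1 / real q ^ Suc j)"
proof -
  have "K_const q \<le> (\<Prod>j<Suc r. 1 - 1 / real q ^ Suc j)"
    unfolding K_const_def
    using convergent_prod_has_prod[OF convergent_prod_K_const[OF assms]] K_const_factor[OF assms]
    by (intro prod_ge_prodinf) (auto intro: less_imp_le simp del: power_Suc)
  also have "\<dots> = (\<Prod>j<r. 1 - 1 / real q ^ Suc j) * (1 - 1 / real q ^ Suc r)"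
    by simp
  also have "\<dots> < (\<Prod>j<r. 1 - 1 / real q ^ Suc j) * 1"
    using K_const_factor[OF assms] by (intro mult_strict_left_mono prod_pos) auto
  finally show ?thesis
    by simp
qed

lemma prod_power_diff:
  assumes "q > 1"
  shows "real (\<Prod>i<r. q ^ r - q ^ i) = real q ^ (r * r) * (\<Prod>j<r. 1 - 1 / real q ^ Suc j)"
proof -
  have "real (\<Prod>i<r. q ^ r - q ^ i) = (\<Prod>i<r. real q ^ r - real q ^ i)"
    unfolding of_nat_prod
    by (intro prod.cong) (use assms in \<open>auto intro: power_increasing\<close>)
  \<comment> \<open>Reversing the order of the factors, \<open>i = r - Suc j\<close>, lets
    \<open>q ^ r\<close> be pulled out of each so that the factors of \<open>K_const\<close>
    remain.\<close>
  also have "\<dots> = (\<Prod>j<r. real q ^ r - real q ^ (r - Suc j))"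
    by (rule prod.nat_diff_reindex[symmetric])
  also have "\<dots> = (\<Prod>j<r. real q ^ r * (1 - 1 / real q ^ Suc j))"
    by (intro prod.cong) (use assms in \<open>auto simp: power_diff right_diff_distrib simp del: power_Suc\<close>)
  finally show ?thesis
    by (simp add: prod.distrib power_mult)
qed

theorem lemma5:
  fixes F :: "('a, 'b) ring_scheme" and K :: "'a set" and q m n r :: nat
  assumes "primepow q" and "m > 0" and "n > 0"
    and "field F" and "order F = q ^ m"
    and "subfield K F" and "card K = q"
    and "r \<le> min n m"
  shows "real q ^ (r * (m + n - r)) \<le> real (rank_ball_volume F K n r)
    \<and> real (rank_ball_volume F K n r) < inverse (K_const q) * real q ^ (r * (m + n - r))"
proof
  interpret field F
    by fact
  have q: "q > 1"
    using primepow_gt_Suc_0[OF assms(1)] by simp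
  have finK: "finite K"
    using q assms(7) card.infinite by fastforce
  \<comment> \<open>Infinite sets have cardinality 0, so this also shows that \<open>F\<close> is
    finite.\<close>
  have "card (carrier F) > 0"
    using assms(5) q by (simp add: order_def)
  then have dim: "dimension m K (carrier F)"
    using dimension_carrier[OF assms(6)] assms(5,7) q card_gt_0_iff by blast
  have r: "r \<le> m" "r \<le> n"
    using assms(8) by auto
  have "q ^ (r * (m + n - r)) \<le> rank_ball_volume F K n r"
    using rank_ball_volume_ge[OF assms(6) finK dim r] assms(7) by simp
  then show "real q ^ (r * (m + n - r)) \<le> real (rank_ball_volume F K n r)"
    by (metis of_nat_le_iff of_nat_power)
  let ?V = "real (rank_ball_volume F K n r)"
  let ?P = "\<Prod>j<r. 1 - 1 / real q ^ Suc j"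
  have "0 < q ^ (r * (m + n - r))"
    using q by simp
  with \<open>_ \<le> rank_ball_volume F K n r\<close> have V: "?V > 0"
    by linarith
  have "rank_ball_volume F K n r * (\<Prod>i<r. q ^ r - q ^ i) \<le> q ^ (r * (m + n))"
    using rank_ball_volume_mult_le[OF assms(6) finK dim r(1)] assms(7) by simp
  then have "?V * (real q ^ (r * r) * ?P) \<le> real q ^ (r * (m + n))"
    using prod_power_diff[OF q, of r] by (metis of_nat_le_iff of_nat_mult of_nat_power)
  \<comment> \<open>The subtraction on naturals is exact because \<open>r \<le> m\<close>. The power
    \<open>q ^ (r * r)\<close> split off here cancels the one from the ordered bases.\<close>
  also have "r * (m + n) = r * r + r * (m + n - r)"
    using r(1) by (simp flip: distrib_left)
  finally have "real q ^ (r * r) * (?V * ?P) \<le> real q ^ (r * r) * real q ^ (r * (m + n - r))"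
    by (simp only: power_add mult_ac)
  then have "?V * ?P \<le> real q ^ (r * (m + n - r))"
    using q by (subst (asm) mult_le_cancel_left_pos) auto
  \<comment> \<open>Strictness of the upper bound enters here, which is why \<open>?V\<close> must
    be positive; the lower bound has provided that.\<close>
  moreover have "?V * K_const q < ?V * ?P"
    using K_const_less[OF q] V by (intro mult_strict_left_mono)
  ultimately have "?V * K_const q < real q ^ (r * (m + n - r))"
    by linarith
  then show "?V < inverse (K_const q) * real q ^ (r * (m + n - r))"
    using K_const_pos[OF q] by (simp add: field_simps)
qed

end
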